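(* Let $d\geq 2$ and let $\mathsf{\Phi}=\{\varphi_1,\ldots,\varphi_d\}$ be an admissible family of $C^2$ mappings $\varphi_j:\mathbb{R}^d\to\mathbb{R}$. Then for every Borel $1$-rectifiable set $E\subseteq\mathbb{R}^d$ satisfying $\mathcal{H}^1(E)>0$ there exists some $j_E\in\{1,\ldots,d\}$ such that $$\mathcal{H}^1\big(\varphi_{j_E}(E)\big)>0.$$ In particular, $\mathsf{\Phi}$ has the good witness property for rectifiable $1$-sets.
   Context: $\mathcal{H}^1$ is $1$-dimensional Hausdorff measure. A Borel set $E\subseteq\mathbb{R}^d$ is $1$-rectifiable if there are Lipschitz maps $f_j:\mathbb{R}\to\mathbb{R}^d$, $j\in\mathbb{N}$, with $\mathcal{H}^1(E\setminus\bigcup_j f_j(\mathbb{R}))=0$. A rectifiable $1$-set is a Borel $1$-rectifiable set with $0<\mathcal{H}^1(E)<\infty$. A family $\{\varphi_1,\ldots,\varphi_d\}$ has the good witness property for rectifiable $1$-sets if for every rectifiable $1$-set $E\subseteq\mathbb{R}^d$ there is an index $j$ with $\mathcal{H}^1(\varphi_j(E))>0$. For a family of $C^2$ maps $\varphi_1,\ldots,\varphi_d:\mathbb{R}^d\to\mathbb{R}$, the canonical encoding map is $\mathsf{H}(x)=(\varphi_1(x),\ldots,\varphi_d(x))$, with derivative $D_x\mathsf{H}(x)$, and the critical set is $\Sigma=\{x\in\mathbb{R}^d:\operatorname{rank}D_x\mathsf{H}(x)\leq d-1\}$. The family is admissible if there is a $C^1$ embedded submanifold $M\subset\mathbb{R}^d$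 of dimension $d-1$ such that (1) (critical-hypersurface condition) $\Sigma\subseteq M$, and (2) (tangential-immersion condition) $\operatorname{rank}\big(D_x\mathsf{H}(x)|_{T_xM}\big)=d-1$ for every $x\in M$. The empty set counts as an embedded hypersurface, so a family with $\Sigma=\emptyset$ is admissible with $M=\emptyset$. *)

theory Defs
  imports "HOL-Analysis.Analysis"
begin

text \<open>The library's \<open>diameter\<close> is a real number and is unspecified on unbounded sets;
  this version takes the value \<open>\<infinity>\<close> there, and 0 on the empty set.\<close>

definition ediam :: "'a::metric_space set \<Rightarrow> ennreal" where
  "ediam A = (SUP x\<in>A. SUP y\<in>A. ennreal (dist x y))"

text \<open>1-dimensional Hausdorff (outer) measure, defined on all sets. The members of a cover may be
  empty, so sequences also account for finite covers. In dimension 1 the usual normalising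
  constant is 1.\<close>

definition hausdorff1_pre :: "real \<Rightarrow> 'a::metric_space set \<Rightarrow> ennreal" where
  "hausdorff1_pre \<delta> E =
     (INF A \<in> {A :: nat \<Rightarrow> 'a set. E \<subseteq> (\<Union>i. A i) \<and> (\<forall>i. ediam (A i) \<le> ennreal \<delta>)}.
        (\<Sum>i. ediam (A i)))"

definition hausdorff1 :: "'a::metric_space set \<Rightarrow> ennreal" where
  "hausdorff1 E = (SUP \<delta> \<in> {0<..}. hausdorff1_pre \<delta> E)"

definition borel_rectifiable1 :: "'a::euclidean_space set \<Rightarrow> bool" where
  "borel_rectifiable1 E \<longleftrightarrow> E \<in> sets borel \<and>
     (\<exists>f :: nat \<Rightarrow> real \<Rightarrow> 'a.
        (\<forall>j. \<exists>L. L-lipschitz_on UNIV (f j)) \<and> hausdorff1 (E - (\<Union>j. range (f j))) = 0)"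

definition rectifiable_1set :: "'a::euclidean_space set \<Rightarrow> bool" where
  "rectifiable_1set E \<longleftrightarrow> borel_rectifiable1 E \<and> 0 < hausdorff1 E \<and> hausdorff1 E < \<infinity>"

text \<open>A family of \<open>d\<close> functions on \<open>\<real>\<^sup>d\<close> is indexed by the same finite type \<open>'n\<close> as the
  coordinates, with \<open>d = CARD('n)\<close>.\<close>

definition good_witness_property :: "('n \<Rightarrow> real ^ 'n \<Rightarrow> real) \<Rightarrow> bool" where
  "good_witness_property \<phi> \<longleftrightarrow>
     (\<forall>E. rectifiable_1set E \<longrightarrow> (\<exists>j. hausdorff1 (\<phi> j ` E) > 0))"

text \<open>\<open>C\<^sup>1\<close> and \<open>C\<^sup>2\<close> on an open set, with continuity of the derivatives taken in the operator
  norm.\<close>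

definition C1_on :: "'a::real_normed_vector set \<Rightarrow> ('a \<Rightarrow> 'b::real_normed_vector) \<Rightarrow> bool" where
  "C1_on U f \<longleftrightarrow> (\<exists>f' :: 'a \<Rightarrow> 'a \<Rightarrow>\<^sub>L 'b.
     (\<forall>x\<in>U. (f has_derivative blinfun_apply (f' x)) (at x)) \<and> continuous_on U f')"

definition C2_on :: "'a::real_normed_vector set \<Rightarrow> ('a \<Rightarrow> 'b::real_normed_vector) \<Rightarrow> bool" where
  "C2_on U f \<longleftrightarrow> (\<exists>f' :: 'a \<Rightarrow> 'a \<Rightarrow>\<^sub>L 'b.
     (\<forall>x\<in>U. (f has_derivative blinfun_apply (f' x)) (at x)) \<and> C1_on U f')"

definition C1_diffeo ::
  "'a::real_normed_vector set \<Rightarrow> 'b::real_normed_vector set \<Rightarrow> ('a \<Rightarrow> 'b) \<Rightarrow> ('b \<Rightarrow> 'a) \<Rightarrow> bool" where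
  "C1_diffeo U V f g \<longleftrightarrow> open U \<and> open V \<and> homeomorphism U V f g \<and> C1_on U f \<and> C1_on V g"

text \<open>Slice charts. A linear subspace \<open>S\<close> of dimension \<open>k\<close> replaces the coordinate subspace
  \<open>\<real>\<^sup>k \<times> {0}\<close>; the two differ by a linear change of coordinates in the chart.
  \<open>M\<close> need not be closed, and \<open>M = {}\<close> is a submanifold of every dimension.\<close>

definition C1_submanifold :: "nat \<Rightarrow> 'a::euclidean_space set \<Rightarrow> bool" where
  "C1_submanifold k M \<longleftrightarrow>
     (\<forall>p\<in>M. \<exists>U V (S :: 'a set) (f :: 'a \<Rightarrow> 'a) g.
        p \<in> U \<and> C1_diffeo U V f g \<and> subspace S \<and> dim S = k \<and> f ` (U \<inter> M) = V \<inter> S)"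

text \<open>The tangent space as the set of velocities of \<open>C\<^sup>1\<close> curves in \<open>M\<close> through \<open>x\<close>.\<close>

definition tangent_space :: "'a::euclidean_space set \<Rightarrow> 'a \<Rightarrow> 'a set" where
  "tangent_space M x =
     {v. \<exists>\<epsilon>>0. \<exists>\<gamma> :: real \<Rightarrow> 'a. \<gamma> C1_differentiable_on {-\<epsilon><..<\<epsilon>} \<and> \<gamma> ` {-\<epsilon><..<\<epsilon>} \<subseteq> M \<and>
         \<gamma> 0 = x \<and> (\<gamma> has_vector_derivative v) (at 0)}"

definition encoding_map :: "('n \<Rightarrow> real ^ 'n \<Rightarrow> real) \<Rightarrow> real ^ 'n \<Rightarrow> real ^ 'n" where
  "encoding_map \<phi> x = (\<chi> j. \<phi> j x)"

definition critical_set :: "('n::finite \<Rightarrow> real ^ 'n \<Rightarrow> real) \<Rightarrow> (real ^ 'n) set" where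
  "critical_set \<phi> =
     {x. rank (matrix (frechet_derivative (encoding_map \<phi>) (at x))) \<le> CARD('n) - 1}"

text \<open>The rank of the derivative restricted to the tangent space is the dimension of the image of
  the tangent space.\<close>

definition admissible :: "('n::finite \<Rightarrow> real ^ 'n \<Rightarrow> real) \<Rightarrow> bool" where
  "admissible \<phi> \<longleftrightarrow> (\<exists>M. C1_submanifold (CARD('n) - 1) M \<and> critical_set \<phi> \<subseteq> M \<and>
     (\<forall>x\<in>M. dim (frechet_derivative (encoding_map \<phi>) (at x) ` tangent_space M x) = CARD('n) - 1))"

end

theory Submission
  imports Defs
begin

text \<open>Write \<open>H\<close> for the encoding map and suppose that all \<open>\<phi>\<^sub>j(E)\<close> are null. Along a Lipschitz curve
  \<open>f\<close> put \<open>g = H \<circ> f\<close> and \<open>A = f\<^sup>-\<^sup>1(E)\<close>. Each coordinate \<open>g\<^sub>j\<close> is locally Lipschitz with \<open>g\<^sub>j(A)\<close> null,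
  so the oscillation of \<open>g\<close> over an interval is at most a constant times the measure of the part of
  the interval outside \<open>A\<close>. Covering \<open>A\<close> by the components of a slightly larger open set
  shows that \<open>g(A)\<close> is null. Hence \<open>H(E)\<close> is null up to the exceptional null part of \<open>E\<close>.

  To return from \<open>H(E)\<close> to \<open>E\<close>, note that \<open>H\<close> has a Lipschitz inverse near
  every regular point, while near every point of \<open>M\<close> the tangential-immersion condition gives
  the restriction of \<open>H\<close> to \<open>M\<close> a Lipschitz inverse. As \<open>\<Sigma> \<subseteq> M\<close>, the regular points and \<open>M\<close>
  together exhaust the space, and countably many of these neighbourhoods suffice.\<close>

section \<open>Null sets of the Hausdorff measure\<close>

lemma ediam_le:
  assumes "\<And>x y. x \<in> A \<Longrightarrow> y \<in> A \<Longrightarrow> ennreal (dist x y) \<le> c"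
  shows "ediam A \<le> c"
  unfolding ediam_def by (intro SUP_least assms)

lemma dist_le_ediam: "x \<in> A \<Longrightarrow> y \<in> A \<Longrightarrow> ennreal (dist x y) \<le> ediam A"
  unfolding ediam_def by (meson SUP_upper2 SUP_upper)

lemma ediam_le_scaled:
  assumes "\<And>x y. x \<in> A \<Longrightarrow> y \<in> A \<Longrightarrow> dist x y \<le> C * dist (h x) (h y)" "C \<ge> 0" "h ` A \<subseteq> B"
  shows "ediam A \<le> ennreal C * ediam B"
proof (rule ediam_le)
  fix x y assume xy: "x \<in> A" "y \<in> A"
  have "ennreal (dist x y) \<le> ennreal (C * dist (h x) (h y))"
    by (rule ennreal_leI) (rule assms(1)[OF xy])
  also have "\<dots> = ennreal C * ennreal (dist (h x) (h y))"
    using assms(2) by (simp add: ennreal_mult)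
  also have "\<dots> \<le> ennreal C * ediam B"
    using assms(3) xy by (intro mult_left_mono dist_le_ediam) auto
  finally show "ennreal (dist x y) \<le> ennreal C * ediam B" .
qed

text \<open>For null sets the scale is irrelevant: if the diameters of a cover sum to at most
  \<open>d\<close>, each member has diameter at most \<open>d\<close>, so a small total already
  forces a fine cover.\<close>

lemma hausdorff1_eq_0_iff:
  "hausdorff1 E = 0 \<longleftrightarrow>
    (\<forall>e>0. \<exists>A :: nat \<Rightarrow> _. E \<subseteq> (\<Union>i. A i) \<and> (\<Sum>i. ediam (A i)) \<le> ennreal e)"
proof
  assume 0: "hausdorff1 E = 0"
  show "\<forall>e>0. \<exists>A. E \<subseteq> (\<Union>i. A i) \<and> (\<Sum>i. ediam (A i)) \<le> ennreal e"
  proof (intro allI impI)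
    fix e :: real assume "e > 0"
    have "hausdorff1_pre 1 E \<le> hausdorff1 E"
      unfolding hausdorff1_def by (intro SUP_upper) auto
    with 0 \<open>e > 0\<close> have "hausdorff1_pre 1 E < ennreal e" by simp
    then obtain A where "E \<subseteq> (\<Union>i. A i)" "(\<Sum>i. ediam (A i)) < ennreal e"
      unfolding hausdorff1_pre_def INF_less_iff by auto
    then show "\<exists>A. E \<subseteq> (\<Union>i. A i) \<and> (\<Sum>i. ediam (A i)) \<le> ennreal e"
      using less_imp_le by blast
  qed
next
  assume *: "\<forall>e>0. \<exists>A. E \<subseteq> (\<Union>i. A i) \<and> (\<Sum>i. ediam (A i)) \<le> ennreal e"
  have "hausdorff1_pre d E \<le> 0" if "d > 0" for d
  proof (rule ennreal_le_epsilon)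
    fix e :: real assume "e > 0"
    with * \<open>d > 0\<close> obtain A where A: "E \<subseteq> (\<Union>i. A i)" "(\<Sum>i. ediam (A i)) \<le> ennreal (min d e)"
      by (metis min_less_iff_conj)
    have "ediam (A i) \<le> ennreal d" for i
    proof -
      have "ediam (A i) \<le> (\<Sum>i. ediam (A i))"
        using sum_le_suminf[OF summableI, of "{i}" "\<lambda>i. ediam (A i)"] by simp
      also have "\<dots> \<le> ennreal d" using A(2) by (rule order_trans) (simp add: ennreal_leI)
      finally show ?thesis .
    qed
    then have "hausdorff1_pre d E \<le> (\<Sum>i. ediam (A i))"
      unfolding hausdorff1_pre_def using A(1) by (intro INF_lower) auto
    also have "\<dots> \<le> 0 + ennreal e" using A(2) by (rule order_trans) (simp add: ennreal_leI)
    finally show "hausdorff1_pre d E \<le> 0 + ennreal e" .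
  qed
  then show "hausdorff1 E = 0"
    unfolding hausdorff1_def by (auto simp: SUP_eq_iff intro!: SUP_eqI)
qed

lemma hausdorff1_null_mono: "hausdorff1 B = 0 \<Longrightarrow> A \<subseteq> B \<Longrightarrow> hausdorff1 A = 0"
  unfolding hausdorff1_eq_0_iff by (meson subset_trans)

lemma hausdorff1_null_UN:
  assumes "\<And>i::nat. hausdorff1 (E i) = 0"
  shows "hausdorff1 (\<Union>i. E i) = 0"
  unfolding hausdorff1_eq_0_iff
proof (intro allI impI)
  fix e :: real assume "e > 0"
  have "\<exists>A. E i \<subseteq> (\<Union>k. A k) \<and> (\<Sum>k. ediam (A k)) \<le> ennreal (e * (1/2)^Suc i)" for i
    using assms[of i] \<open>e > 0\<close> unfolding hausdorff1_eq_0_iff by simp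
  then obtain A where A: "\<And>i. E i \<subseteq> (\<Union>k. A i k)"
      "\<And>i. (\<Sum>k. ediam (A i k)) \<le> ennreal (e * (1/2)^Suc i)"
    by metis
  \<comment> \<open>The double family of covers is listed as one sequence by the pairing function;
    the budgets e/2^(i+1) add up to \<open>e\<close>.\<close>
  define B where "B = (\<lambda>n. case prod_decode n of (i, k) \<Rightarrow> A i k)"
  have "(\<Union>i. E i) \<subseteq> (\<Union>n. B n)"
  proof clarify
    fix x i assume "x \<in> E i"
    then obtain k where "x \<in> A i k" using A(1) by blast
    then have "x \<in> B (prod_encode (i, k))" by (simp add: B_def)
    then show "x \<in> (\<Union>n. B n)" by blast
  qed
  moreover have "(\<Sum>n. ediam (B n)) \<le> ennreal e"
  proof -
    have "(\<Sum>n. ediam (B n)) = (\<Sum>n. (\<lambda>(i, k). ediam (A i k)) (prod_decode n))"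
      by (simp add: B_def case_prod_unfold)
    also have "\<dots> = (\<Sum>i. \<Sum>k. ediam (A i k))"
      by (rule suminf_ennreal_2dimen) simp
    also have "\<dots> \<le> (\<Sum>i. ennreal (e * (1/2)^Suc i))"
      by (intro suminf_le A(2) summableI)
    also have "\<dots> = ennreal e"
      using sums_mult[OF power_half_series, of e] \<open>e > 0\<close>
      by (intro suminf_ennreal_eq) auto
    finally show ?thesis .
  qed
  ultimately show "\<exists>A. (\<Union>i. E i) \<subseteq> (\<Union>i. A i) \<and> (\<Sum>i. ediam (A i)) \<le> ennreal e"
    by blast
qed

lemma hausdorff1_empty: "hausdorff1 {} = 0"
  unfolding hausdorff1_eq_0_iff
  by (auto intro!: exI[of _ "\<lambda>_. {}"] simp: ediam_def bot_ennreal)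

lemma hausdorff1_null_Un:
  assumes "hausdorff1 A = 0" "hausdorff1 B = 0"
  shows "hausdorff1 (A \<union> B) = 0"
proof -
  have "A \<union> B = (\<Union>i::nat. if i = 0 then A else B)"
    by (auto split: if_splits intro: exI[of _ "0::nat"] exI[of _ "1::nat"])
  then show ?thesis using hausdorff1_null_UN[of "\<lambda>i. if i = 0 then A else B"] assms by simp
qed

lemma hausdorff1_null_Union:
  assumes "countable \<F>" "\<And>E. E \<in> \<F> \<Longrightarrow> hausdorff1 E = 0"
  shows "hausdorff1 (\<Union>\<F>) = 0"
proof (cases "\<F> = {}")
  case False
  then have "hausdorff1 (\<Union>i. from_nat_into \<F> i) = 0"
    using assms by (intro hausdorff1_null_UN) (simp add: from_nat_into)
  then show ?thesis using False assms(1) by (simp add: range_from_nat_into)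
qed (simp add: hausdorff1_empty)

text \<open>A cover of the image pulls back under \<open>h\<close> to a cover of \<open>E\<close>
  whose diameters grow by a constant factor at most.\<close>

lemma hausdorff1_null_of_lower_Lipschitz:
  assumes "\<And>x y. x \<in> E \<Longrightarrow> y \<in> E \<Longrightarrow> dist x y \<le> C * dist (h x) (h y)"
    and null: "hausdorff1 (h ` E) = 0"
  shows "hausdorff1 E = 0"
  unfolding hausdorff1_eq_0_iff
proof (intro allI impI)
  fix e :: real assume "e > 0"
  \<comment> \<open>\<open>C\<close> may be zero or negative, whereas the budget
    \<open>e / D\<close> needs a positive constant.\<close>
  define D where "D = max C 1"
  have D: "D > 0" "\<And>x y. x \<in> E \<Longrightarrow> y \<in> E \<Longrightarrow> dist x y \<le> D * dist (h x) (h y)"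
    unfolding D_def by (force, meson assms(1) max.cobounded1 mult_right_mono order_trans zero_le_dist)
  obtain A where A: "h ` E \<subseteq> (\<Union>i. A i)" "(\<Sum>i. ediam (A i)) \<le> ennreal (e / D)"
    using null \<open>e > 0\<close> \<open>D > 0\<close> unfolding hausdorff1_eq_0_iff by (metis divide_pos_pos)
  define B where "B i = E \<inter> h -` A i" for i :: nat
  have "(\<Sum>i. ediam (B i)) \<le> (\<Sum>i. ennreal D * ediam (A i))"
    by (intro suminf_le summableI ediam_le_scaled) (use D in \<open>auto simp: B_def\<close>)
  also have "\<dots> \<le> ennreal D * ennreal (e / D)"
    using A(2) by (simp add: mult_left_mono)
  also have "\<dots> = ennreal e" using \<open>D > 0\<close> \<open>e > 0\<close> by (simp flip: ennreal_mult)
  finally have "(\<Sum>i. ediam (B i)) \<le> ennreal e" .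
  moreover have "E \<subseteq> (\<Union>i. B i)" using A(1) unfolding B_def by blast
  ultimately show "\<exists>A. E \<subseteq> (\<Union>i. A i) \<and> (\<Sum>i. ediam (A i)) \<le> ennreal e"
    by blast
qed

text \<open>By Lindelof, countably many of the good open sets already cover \<open>T\<close>, and
  countable unions of null sets are null.\<close>

lemma hausdorff1_null_local:
  fixes T :: "'a::{metric_space, second_countable_topology} set"
  assumes "\<And>p. p \<in> T \<Longrightarrow> \<exists>U. open U \<and> p \<in> U \<and> hausdorff1 (E \<inter> T \<inter> U) = 0"
  shows "hausdorff1 (E \<inter> T) = 0"
proof -
  define \<F> where "\<F> = {U. open U \<and> hausdorff1 (E \<inter> T \<inter> U) = 0}"
  obtain \<G> where \<G>: "\<G> \<subseteq> \<F>" "countable \<G>" "\<Union>\<G> = \<Union>\<F>"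
    using Lindelof[of \<F>] by (auto simp: \<F>_def)
  have "hausdorff1 (\<Union>U\<in>\<G>. E \<inter> T \<inter> U) = 0"
    using \<G> by (intro hausdorff1_null_Union) (auto simp: \<F>_def)
  moreover have "E \<inter> T \<subseteq> (\<Union>U\<in>\<G>. E \<inter> T \<inter> U)"
    using assms \<G>(3) unfolding \<F>_def by blast
  ultimately show ?thesis by (rule hausdorff1_null_mono)
qed

section \<open>Lipschitz curves with null coordinate images\<close>

text \<open>A bounded nonempty \<open>X\<close> lies in the interval centred at any of its points
  with the diameter as radius, hence the factor 2. The Borel set \<open>J\<close> stands in for
  \<open>X\<close>, which may fail to be measurable.\<close>

lemma ediam_cover_real:
  fixes X :: "real set"
  shows "\<exists>J. J \<in> sets borel \<and> X \<subseteq> J \<and> emeasure lebesgue J \<le> 2 * ediam X"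
proof (cases "X = {} \<or> ediam X = top")
  case True
  then show ?thesis
    by (auto intro: exI[of _ "{}"] exI[of _ UNIV] simp: ennreal_mult_top)
next
  case False
  then obtain x where x: "x \<in> X" by blast
  from False obtain r where r: "r \<ge> 0" "ediam X = ennreal r" by (cases "ediam X") auto
  have "\<bar>x - y\<bar> \<le> r" if "y \<in> X" for y
    using dist_le_ediam[OF x that] r by (simp add: dist_real_def)
  then have "X \<subseteq> {x - r..x + r}" by (force simp: abs_le_iff)
  moreover have "emeasure lebesgue {x - r..x + r} = ennreal (2 * r)"
    using r by simp
  ultimately show ?thesis
    using r by (intro exI[of _ "{x - r..x + r}"]) (auto simp: ennreal_mult)
qed

lemma hausdorff1_null_imp_null_sets:
  fixes N :: "real set"
  assumes "hausdorff1 N = 0"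
  shows "N \<in> null_sets lebesgue"
proof -
  have "\<exists>T. N \<subseteq> T \<and> T \<in> lmeasurable \<and> measure lebesgue T \<le> e" if "e > 0" for e
  proof -
    obtain A where A: "N \<subseteq> (\<Union>i. A i)" "(\<Sum>i. ediam (A i)) \<le> ennreal (e / 2)"
      using assms \<open>e > 0\<close> unfolding hausdorff1_eq_0_iff by (metis half_gt_zero)
    have "\<forall>i. \<exists>J. J \<in> sets borel \<and> A i \<subseteq> J \<and> emeasure lebesgue J \<le> 2 * ediam (A i)"
      using ediam_cover_real by blast
    then obtain J where J: "\<And>i. J i \<in> sets borel" "\<And>i. A i \<subseteq> J i"
        "\<And>i. emeasure lebesgue (J i) \<le> 2 * ediam (A i)"
      by metis
    have "emeasure lebesgue (\<Union>i. J i) \<le> (\<Sum>i. emeasure lebesgue (J i))"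
      using J(1) by (intro emeasure_subadditive_countably) auto
    also have "\<dots> \<le> (\<Sum>i. 2 * ediam (A i))"
      by (intro suminf_le J(3) summableI)
    also have "\<dots> \<le> 2 * ennreal (e / 2)"
      using A(2) by (simp add: mult_left_mono)
    also have "\<dots> = ennreal e"
      using \<open>e > 0\<close> by (simp flip: ennreal_mult ennreal_numeral)
    finally have le: "emeasure lebesgue (\<Union>i. J i) \<le> ennreal e" .
    have "(\<Union>i. J i) \<in> lmeasurable"
      using J(1) le by (intro fmeasurableI) (auto simp: le_less_trans)
    moreover have "measure lebesgue (\<Union>i. J i) \<le> e"
      unfolding measure_def using le \<open>e > 0\<close> by (simp add: enn2real_leI)
    ultimately show ?thesis using A(1) J(2) by (intro exI[of _ "\<Union>i. J i"]) blast
  qed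
  then show ?thesis
    unfolding negligible_iff_null_sets[symmetric] negligible_outer_le by blast
qed

text \<open>Outer regularity gives an open \<open>G\<close> around \<open>S\<close> with small
  excess. Its components are countably many disjoint intervals, and cutting them with
  \<open>T\<close> keeps them where a Lipschitz bound is known.\<close>

lemma connected_outer_cover:
  fixes S T :: "real set"
  assumes S: "S \<in> sets lebesgue" "S \<subseteq> T" and T: "connected T" and "e > 0"
  shows "\<exists>I :: nat \<Rightarrow> real set. disjoint_family I \<and> (\<forall>n. connected (I n)) \<and> (\<forall>n. I n \<in> sets lebesgue) \<and>
    (\<forall>n. I n \<subseteq> T) \<and> S \<subseteq> (\<Union>n. I n) \<and> emeasure lebesgue ((\<Union>n. I n) - S) \<le> ennreal e"
proof -
  obtain G where G: "open G" "S \<subseteq> G" "emeasure lebesgue (G - S) < ennreal e"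
    using sets_lebesgue_outer_open[OF S(1) \<open>e > 0\<close>] by blast
  let ?C = "components G"
  have disj: "pairwise disjnt ?C"
    by (auto simp: pairwise_def disjnt_def components_nonoverlap)
  have countable: "countable ?C"
    using G(1) disj by (intro countable_disjoint_open_subsets) (auto intro: open_components)
  \<comment> \<open>\<open>I n\<close> comes from the component numbered \<open>n\<close> and is
    empty if no component has that number, so finitely many components also yield a full
    sequence.\<close>
  define I where "I n = T \<inter> \<Union>{C \<in> ?C. to_nat_on ?C C = n}" for n
  have single: "\<exists>C\<in>?C. I n \<subseteq> C \<and> I n = T \<inter> C" if "I n \<noteq> {}" for n
  proof -
    from that obtain C where C: "C \<in> ?C" "to_nat_on ?C C = n" by (auto simp: I_def)
    then have "{C \<in> ?C. to_nat_on ?C C = n} = {C}"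
      using countable by auto
    then have "I n = T \<inter> C" by (simp add: I_def)
    with C show ?thesis by blast
  qed
  have con: "connected (I n)" for n
  proof (cases "I n = {}")
    case False
    then obtain C where "C \<in> ?C" "I n = T \<inter> C" using single by blast
    then show ?thesis
      using T by (metis in_components_connected is_interval_Int is_interval_connected_1)
  qed simp
  show ?thesis
  proof (intro exI[of _ I] conjI allI)
    show "disjoint_family I"
      using disj by (fastforce simp: disjoint_family_on_def I_def pairwise_def disjnt_iff)
    show "I n \<in> sets lebesgue" for n
      using con[of n] real_interval_borel_measurable[of "I n"] by (simp add: is_interval_connected_1)
    have UI: "(\<Union>n. I n) = T \<inter> G"
      using Union_components[of G] unfolding I_def by blast
    then show "S \<subseteq> (\<Union>n. I n)" using S G by blast
    have "emeasure lebesgue ((\<Union>n. I n) - S) \<le> emeasure lebesgue (G - S)"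
      using UI S(1) G(1) by (intro emeasure_mono) auto
    with G(3) show "emeasure lebesgue ((\<Union>n. I n) - S) \<le> ennreal e" by simp
  qed (use con in \<open>auto simp: I_def\<close>)
qed

lemma ediam_connected_le:
  fixes I :: "real set"
  assumes "connected I" "I \<in> sets lebesgue"
  shows "ediam I \<le> emeasure lebesgue I"
proof (rule ediam_le)
  fix x y assume "x \<in> I" "y \<in> I"
  then have "{min x y..max x y} \<subseteq> I"
    using assms(1) by (intro connected_contains_Icc) (auto simp: min_def max_def)
  then have "emeasure lebesgue {min x y..max x y} \<le> emeasure lebesgue I"
    using assms(2) by (intro emeasure_mono)
  moreover have "max x y - min x y = dist x y" by (auto simp: dist_real_def)
  ultimately show "ennreal (dist x y) \<le> emeasure lebesgue I" by simp
qed

text \<open>By the intermediate value theorem \<open>g\<close> maps \<open>[s, t]\<close> onto the segment between \<open>g s\<close> and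
  \<open>g t\<close>, and \<open>g\<close> of the part inside \<open>A\<close> is negligible. This substitutes for the fact that
  \<open>g' = 0\<close> almost everywhere on \<open>A\<close>. The factor 2 is not sharp.\<close>

lemma dist_le_measure_off_null_image:
  fixes g :: "real \<Rightarrow> real"
  assumes lip: "L-lipschitz_on {a..b} g" and A: "A \<in> sets lebesgue"
    and null: "hausdorff1 (g ` (A \<inter> {a..b})) = 0"
    and st: "a \<le> s" "s \<le> t" "t \<le> b"
  shows "ennreal (dist (g s) (g t)) \<le> ennreal (2 * L) * emeasure lebesgue ({s..t} - A)"
proof (rule ennreal_le_epsilon)
  fix e :: real assume "e > 0"
  have "L \<ge> 0" using lip by (rule lipschitz_on_nonneg)
  let ?S = "{s..t} - A"
  \<comment> \<open>The summand 1 keeps the denominator positive when \<open>L = 0\<close>.\<close>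
  define d where "d = e / (2 * L + 1)"
  have d: "d > 0" "2 * L * d \<le> e"
    using \<open>e > 0\<close> \<open>L \<ge> 0\<close> by (auto simp: d_def divide_simps mult_less_0_iff)
  have S: "?S \<in> sets lebesgue" using A by auto
  obtain I :: "nat \<Rightarrow> real set" where "disjoint_family I" "\<forall>n. connected (I n)" "\<forall>n. I n \<in> sets lebesgue"
      "\<forall>n. I n \<subseteq> {s..t}" "?S \<subseteq> (\<Union>n. I n)" "emeasure lebesgue ((\<Union>n. I n) - ?S) \<le> ennreal d"
    using connected_outer_cover[OF S Diff_subset connected_Icc \<open>d > 0\<close>] by (elim exE conjE) (rule that)
  note I = this[rule_format]
  have "\<forall>n. \<exists>J. J \<in> sets borel \<and> g ` I n \<subseteq> J \<and> emeasure lebesgue J \<le> 2 * ediam (g ` I n)"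
    using ediam_cover_real by blast
  then obtain J where J: "\<And>n. J n \<in> sets borel" "\<And>n. g ` I n \<subseteq> J n"
      "\<And>n. emeasure lebesgue (J n) \<le> 2 * ediam (g ` I n)"
    by metis
  have emI: "emeasure lebesgue (J n) \<le> ennreal (2 * L) * emeasure lebesgue (I n)" for n
  proof -
    have "ediam (g ` I n) \<le> ennreal L * ediam (I n)"
    proof (rule ediam_le)
      fix u v assume "u \<in> g ` I n" "v \<in> g ` I n"
      then obtain x y where xy: "x \<in> I n" "u = g x" "y \<in> I n" "v = g y" by blast
      then have "dist u v \<le> L * dist x y"
        using I(4)[of n] st by (auto intro!: lipschitz_onD[OF lip])
      then have "ennreal (dist u v) \<le> ennreal L * ennreal (dist x y)"
        using \<open>L \<ge> 0\<close> by (simp add: ennreal_leI flip: ennreal_mult)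
      also have "\<dots> \<le> ennreal L * ediam (I n)"
        using xy by (intro mult_left_mono dist_le_ediam) auto
      finally show "ennreal (dist u v) \<le> ennreal L * ediam (I n)" .
    qed
    also have "\<dots> \<le> ennreal L * emeasure lebesgue (I n)"
      by (intro mult_left_mono ediam_connected_le I) auto
    finally have "2 * ediam (g ` I n) \<le> 2 * (ennreal L * emeasure lebesgue (I n))"
      by (intro mult_left_mono) auto
    with J(3)[of n] show ?thesis
      using \<open>L \<ge> 0\<close> by (simp add: ennreal_mult mult.assoc)
  qed
  have "closed_segment (g s) (g t) \<subseteq> g ` {s..t}"
  proof -
    have "continuous_on {s..t} g"
      using lip st by (intro continuous_on_subset[OF lipschitz_on_continuous_on]) auto
    then have "connected (g ` {s..t})"
      by (intro connected_continuous_image) auto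
    then have "convex (g ` {s..t})"
      by (metis is_interval_connected_1 is_interval_convex_1)
    then show ?thesis
      using st by (intro closed_segment_subset) auto
  qed
  also have "\<dots> \<subseteq> g ` (A \<inter> {a..b}) \<union> (\<Union>n. J n)"
  proof
    fix u assume "u \<in> g ` {s..t}"
    then obtain x where x: "x \<in> {s..t}" "u = g x" by blast
    show "u \<in> g ` (A \<inter> {a..b}) \<union> (\<Union>n. J n)"
    proof (cases "x \<in> A")
      case True
      then have "x \<in> A \<inter> {a..b}" using x st by simp
      then show ?thesis using x by blast
    next
      case False
      then show ?thesis using x I(5) J(2) by blast
    qed
  qed
  finally have sub: "closed_segment (g s) (g t) \<subseteq> g ` (A \<inter> {a..b}) \<union> (\<Union>n. J n)" .
  have N: "g ` (A \<inter> {a..b}) \<in> null_sets lebesgue"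
    by (rule hausdorff1_null_imp_null_sets[OF null])
  have UJ: "(\<Union>n. J n) \<in> sets lebesgue" using J(1) by auto
  \<comment> \<open>The null image of \<open>A\<close> drops out. The sets \<open>J n\<close> have
    total measure at most \<open>2 * L\<close> times that of the union of the \<open>I n\<close>,
    which exceeds the measure of \<open>?S\<close> by at most \<open>d\<close>.\<close>
  have "ennreal (dist (g s) (g t)) = emeasure lebesgue (closed_segment (g s) (g t))"
    by (simp add: closed_segment_eq_real_ivl dist_real_def)
  also have "\<dots> \<le> emeasure lebesgue (g ` (A \<inter> {a..b}) \<union> (\<Union>n. J n))"
    using sub N UJ by (intro emeasure_mono) auto
  also have "\<dots> = emeasure lebesgue (\<Union>n. J n)"
    using N UJ by (metis emeasure_Un_null_set sup_commute)
  also have "\<dots> \<le> (\<Sum>n. emeasure lebesgue (J n))"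
    using J(1) by (intro emeasure_subadditive_countably) auto
  also have "\<dots> \<le> (\<Sum>n. ennreal (2 * L) * emeasure lebesgue (I n))"
    by (intro suminf_le emI summableI)
  also have "\<dots> = ennreal (2 * L) * emeasure lebesgue (\<Union>n. I n)"
  proof -
    have "(\<Sum>n. emeasure lebesgue (I n)) = emeasure lebesgue (\<Union>n. I n)"
      by (rule suminf_emeasure) (use I(1,3) in auto)
    then show ?thesis by (simp only: ennreal_suminf_cmult)
  qed
  also have "emeasure lebesgue (\<Union>n. I n) \<le> emeasure lebesgue ?S + ennreal d"
  proof -
    have UI: "(\<Union>n. I n) \<in> sets lebesgue" using I(3) by auto
    have "emeasure lebesgue (\<Union>n. I n) = emeasure lebesgue (?S \<union> ((\<Union>n. I n) - ?S))"
      using I(5) by (intro arg_cong[of _ _ "emeasure lebesgue"]) blast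
    also have "\<dots> \<le> emeasure lebesgue ?S + emeasure lebesgue ((\<Union>n. I n) - ?S)"
      using S UI by (intro emeasure_subadditive) auto
    also have "\<dots> \<le> emeasure lebesgue ?S + ennreal d"
      using I(6) by (intro add_left_mono)
    finally show ?thesis .
  qed
  also have "ennreal (2 * L) * (emeasure lebesgue ?S + ennreal d)
      = ennreal (2 * L) * emeasure lebesgue ?S + ennreal (2 * L * d)"
    using \<open>L \<ge> 0\<close> \<open>d > 0\<close> by (simp add: distrib_left ennreal_mult)
  also have "\<dots> \<le> ennreal (2 * L) * emeasure lebesgue ?S + ennreal e"
    using d(2) by (intro add_left_mono ennreal_leI)
  finally show "ennreal (dist (g s) (g t)) \<le> ennreal (2 * L) * emeasure lebesgue ?S + ennreal e"
    by (simp add: mult_left_mono)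
qed

text \<open>The oscillation of \<open>g\<close> on an interval is at most \<open>K\<close> times the
  measure of its part outside \<open>A\<close>. Over disjoint intervals that cover \<open>A\<close>
  with excess at most \<open>d\<close> these bounds sum to at most \<open>K * d\<close>, so the
  images of the intervals form a cover of small total diameter.\<close>

lemma hausdorff1_curve_null_of_coordinates_null:
  fixes g :: "real \<Rightarrow> real ^ 'n"
  assumes lip: "L-lipschitz_on {a..b} g" and A: "A \<in> sets lebesgue"
    and null: "\<And>j. hausdorff1 ((\<lambda>t. g t $ j) ` (A \<inter> {a..b})) = 0"
  shows "hausdorff1 (g ` (A \<inter> {a..b})) = 0"
  unfolding hausdorff1_eq_0_iff
proof (intro allI impI)
  fix e :: real assume "e > 0"
  have "L \<ge> 0" using lip by (rule lipschitz_on_nonneg)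
  \<comment> \<open>Each coordinate contributes \<open>2 * L\<close>, and the Euclidean norm is at
    most the sum of the absolute values of the coordinates.\<close>
  define K where "K = real CARD('n) * (2 * L)"
  have "K \<ge> 0" using \<open>L \<ge> 0\<close> by (simp add: K_def)
  define d where "d = e / (K + 1)"
  have d: "d > 0" "K * d \<le> e"
    using \<open>e > 0\<close> \<open>K \<ge> 0\<close> by (auto simp: d_def divide_simps)
  let ?S = "A \<inter> {a..b}"
  have S: "?S \<in> sets lebesgue" using A by auto
  obtain I :: "nat \<Rightarrow> real set" where "disjoint_family I" "\<forall>n. connected (I n)" "\<forall>n. I n \<in> sets lebesgue"
      "\<forall>n. I n \<subseteq> {a..b}" "?S \<subseteq> (\<Union>n. I n)" "emeasure lebesgue ((\<Union>n. I n) - ?S) \<le> ennreal d"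
    using connected_outer_cover[OF S Int_lower2 connected_Icc \<open>d > 0\<close>] by (elim exE conjE) (rule that)
  note I = this[rule_format]
  have gap: "ennreal (dist (g s) (g t)) \<le> ennreal K * emeasure lebesgue ({s..t} - A)"
    if st: "a \<le> s" "s \<le> t" "t \<le> b" for s t
  proof -
    have coord: "ennreal \<bar>(g s - g t) $ j\<bar> \<le> ennreal (2 * L) * emeasure lebesgue ({s..t} - A)" for j
    proof -
      have "L-lipschitz_on {a..b} (\<lambda>t. g t $ j)"
        using lip by (auto simp: lipschitz_on_def intro: order_trans[OF dist_vec_nth_le])
      from dist_le_measure_off_null_image[OF this A null st] show ?thesis
        by (simp add: dist_real_def)
    qed
    have "ennreal (dist (g s) (g t)) \<le> ennreal (\<Sum>j\<in>UNIV. \<bar>(g s - g t) $ j\<bar>)"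
      unfolding dist_norm by (intro ennreal_leI norm_le_l1_cart)
    also have "\<dots> = (\<Sum>j\<in>UNIV. ennreal \<bar>(g s - g t) $ j\<bar>)"
      by simp
    also have "\<dots> \<le> (\<Sum>j\<in>(UNIV::'n set). ennreal (2 * L) * emeasure lebesgue ({s..t} - A))"
      by (intro sum_mono coord)
    also have "\<dots> = ennreal K * emeasure lebesgue ({s..t} - A)"
      using \<open>L \<ge> 0\<close> by (simp add: K_def ennreal_mult mult.assoc ennreal_of_nat_eq_real_of_nat)
    finally show ?thesis .
  qed
  have diam: "ediam (g ` I n) \<le> ennreal K * emeasure lebesgue (I n - ?S)" for n
  proof (rule ediam_le)
    have *: "ennreal (dist (g x) (g y)) \<le> ennreal K * emeasure lebesgue (I n - ?S)"
      if xy: "x \<in> I n" "y \<in> I n" "x \<le> y" for x y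
    proof -
      \<comment> \<open>As \<open>I n\<close> is an interval inside [a, b], the part of [x, y]
        outside \<open>A\<close> lies in \<open>I n - ?S\<close>.\<close>
      have "{x..y} \<subseteq> I n" using I(2) xy by (intro connected_contains_Icc)
      then have "emeasure lebesgue ({x..y} - A) \<le> emeasure lebesgue (I n - ?S)"
        using I(3) S by (intro emeasure_mono) auto
      then have "ennreal K * emeasure lebesgue ({x..y} - A) \<le> ennreal K * emeasure lebesgue (I n - ?S)"
        by (intro mult_left_mono) auto
      with gap[of x y] xy I(4)[of n] show ?thesis by fastforce
    qed
    fix u v assume "u \<in> g ` I n" "v \<in> g ` I n"
    then obtain x y where "x \<in> I n" "u = g x" "y \<in> I n" "v = g y" by blast
    with *[of x y] *[of y x] show "ennreal (dist u v) \<le> ennreal K * emeasure lebesgue (I n - ?S)"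
      by (metis dist_commute linear)
  qed
  have "(\<Sum>n. ediam (g ` I n)) \<le> (\<Sum>n. ennreal K * emeasure lebesgue (I n - ?S))"
    by (intro suminf_le diam summableI)
  also have "\<dots> = ennreal K * emeasure lebesgue (\<Union>n. I n - ?S)"
  proof -
    have "(\<Sum>n. emeasure lebesgue (I n - ?S)) = emeasure lebesgue (\<Union>n. I n - ?S)"
      by (rule suminf_emeasure) (use I(1,3) S in \<open>auto simp: disjoint_family_on_def\<close>)
    then show ?thesis by (simp only: ennreal_suminf_cmult)
  qed
  also have "(\<Union>n. I n - ?S) = (\<Union>n. I n) - ?S" by blast
  also have "ennreal K * emeasure lebesgue ((\<Union>n. I n) - ?S) \<le> ennreal K * ennreal d"
    using I(6) by (intro mult_left_mono) auto
  also have "\<dots> \<le> ennreal e"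
    using d \<open>K \<ge> 0\<close> by (simp add: ennreal_leI flip: ennreal_mult)
  finally have "(\<Sum>n. ediam (g ` I n)) \<le> ennreal e" .
  moreover have "g ` ?S \<subseteq> (\<Union>n. g ` I n)" using I(5) by blast
  ultimately show "\<exists>B. g ` ?S \<subseteq> (\<Union>n. B n) \<and> (\<Sum>n. ediam (B n)) \<le> ennreal e"
    by blast
qed

section \<open>Local Lipschitz inverses\<close>

text \<open>This is the mean value inequality for \<open>h\<close> minus its linear part
  \<open>h' q\<close>: by continuity of \<open>h'\<close> the derivative of this difference has
  operator norm at most \<open>e\<close> on a small ball, which is convex.\<close>

lemma C1_strict_derivative:
  fixes h :: "'a::euclidean_space \<Rightarrow> 'b::euclidean_space" and h' :: "'a \<Rightarrow> 'a \<Rightarrow>\<^sub>L 'b"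
  assumes V: "open V" "q \<in> V"
    and der: "\<And>x. x \<in> V \<Longrightarrow> (h has_derivative h' x) (at x)"
    and cont: "continuous_on V h'" and "e > 0"
  obtains r where "r > 0" "ball q r \<subseteq> V"
    "\<And>x y. x \<in> ball q r \<Longrightarrow> y \<in> ball q r \<Longrightarrow> norm (h x - h y - h' q (x - y)) \<le> e * norm (x - y)"
proof -
  obtain r1 where r1: "r1 > 0" "ball q r1 \<subseteq> V"
    using V open_contains_ball by blast
  obtain r2 where r2: "r2 > 0" "\<And>x. x \<in> V \<Longrightarrow> dist x q < r2 \<Longrightarrow> dist (h' x) (h' q) < e"
    using cont V(2) \<open>e > 0\<close> unfolding continuous_on_iff by blast
  let ?B = "ball q (min r1 r2)"
  show ?thesis
  proof
    show "min r1 r2 > 0" using r1 r2 by simp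
    show sub: "?B \<subseteq> V" using r1 by auto
    fix x y assume xy: "x \<in> ?B" "y \<in> ?B"
    let ?k = "\<lambda>x. h x - h' q x"
    have "norm (?k x - ?k y) \<le> e * norm (x - y)"
    proof (rule differentiable_bound[OF convex_ball _ _ xy])
      fix z assume z: "z \<in> ?B"
      with sub have "z \<in> V" by blast
      then have "(h has_derivative h' z) (at z within ?B)"
        by (rule has_derivative_at_withinI[OF der])
      then show "(?k has_derivative blinfun_apply (h' z - h' q)) (at z within ?B)"
        unfolding minus_blinfun.rep_eq
        by (rule has_derivative_diff)
          (rule bounded_linear_imp_has_derivative[OF blinfun.bounded_linear_right])
      have "norm (h' z - h' q) \<le> e"
        using r2(2)[OF \<open>z \<in> V\<close>] z by (simp add: dist_commute dist_norm[symmetric])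
      then show "onorm (blinfun_apply (h' z - h' q)) \<le> e"
        by (simp add: norm_blinfun.rep_eq)
    qed
    then show "norm (h x - h y - h' q (x - y)) \<le> e * norm (x - y)"
      by (simp add: blinfun.diff_right algebra_simps)
  qed
qed

lemma C1_upper_Lipschitz_near:
  fixes h :: "'a::euclidean_space \<Rightarrow> 'b::euclidean_space" and h' :: "'a \<Rightarrow> 'a \<Rightarrow>\<^sub>L 'b"
  assumes V: "open V" "q \<in> V"
    and der: "\<And>x. x \<in> V \<Longrightarrow> (h has_derivative h' x) (at x)"
    and cont: "continuous_on V h'"
  obtains r C where "r > 0" "C \<ge> 0" "ball q r \<subseteq> V"
    "\<And>x y. x \<in> ball q r \<Longrightarrow> y \<in> ball q r \<Longrightarrow> dist (h x) (h y) \<le> C * dist x y"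
proof -
  obtain r where r: "r > 0" "ball q r \<subseteq> V"
    "\<And>x y. x \<in> ball q r \<Longrightarrow> y \<in> ball q r \<Longrightarrow> norm (h x - h y - h' q (x - y)) \<le> 1 * norm (x - y)"
    using C1_strict_derivative[OF assms, of 1] by (metis zero_less_one)
  show ?thesis
  proof (rule that[of r "norm (h' q) + 1"])
    fix x y assume "x \<in> ball q r" "y \<in> ball q r"
    from r(3)[OF this] have "norm (h x - h y) \<le> norm (h' q (x - y)) + norm (x - y)"
      by norm
    also have "\<dots> \<le> norm (h' q) * norm (x - y) + norm (x - y)"
      by (intro add_right_mono norm_blinfun)
    finally show "dist (h x) (h y) \<le> (norm (h' q) + 1) * dist x y"
      by (simp add: dist_norm algebra_simps)
  qed (use r in auto)
qed

text \<open>An injective linear map on a finite-dimensional space expands norms by at least some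
  \<open>e > 0\<close>. The strict differentiability error is at most half of that, so
  \<open>e / 2\<close> survives. Below, \<open>S\<close> is the whole space at regular points and
  the slice of a chart at points of \<open>M\<close>.\<close>

lemma C1_lower_Lipschitz_near:
  fixes h :: "'a::euclidean_space \<Rightarrow> 'b::euclidean_space" and h' :: "'a \<Rightarrow> 'a \<Rightarrow>\<^sub>L 'b"
  assumes V: "open V" "q \<in> V"
    and der: "\<And>x. x \<in> V \<Longrightarrow> (h has_derivative h' x) (at x)"
    and cont: "continuous_on V h'"
    and S: "subspace S" "\<And>v. v \<in> S \<Longrightarrow> h' q v = 0 \<Longrightarrow> v = 0"
  obtains r C where "r > 0" "C \<ge> 0" "ball q r \<subseteq> V"
    "\<And>x y. x \<in> ball q r \<Longrightarrow> y \<in> ball q r \<Longrightarrow> x - y \<in> S \<Longrightarrow> dist x y \<le> C * dist (h x) (h y)"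
proof -
  have "\<exists>e>0. \<forall>v\<in>S. norm (h' q v) \<ge> e * norm v"
    by (rule injective_imp_isometric) (use S in \<open>auto intro: closed_subspace blinfun.bounded_linear_right\<close>)
  then obtain e where e: "e > 0" "\<And>v. v \<in> S \<Longrightarrow> norm (h' q v) \<ge> e * norm v"
    by blast
  then have "e / 2 > 0" by simp
  then obtain r where r: "r > 0" "ball q r \<subseteq> V"
    "\<And>x y. x \<in> ball q r \<Longrightarrow> y \<in> ball q r \<Longrightarrow> norm (h x - h y - h' q (x - y)) \<le> e / 2 * norm (x - y)"
    using C1_strict_derivative[OF V der cont, of "e / 2"] by metis
  show ?thesis
  proof (rule that[of r "2 / e"])
    fix x y assume xy: "x \<in> ball q r" "y \<in> ball q r" "x - y \<in> S"
    have "e * norm (x - y) \<le> norm (h x - h y) + e / 2 * norm (x - y)"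
      using r(3)[OF xy(1,2)] e(2)[OF xy(3)] norm_triangle_sub[of "h' q (x - y)" "h x - h y"]
      by (simp add: norm_minus_commute)
    then show "dist x y \<le> 2 / e * dist (h x) (h y)"
      using e(1) by (simp add: dist_norm field_simps)
  qed (use r e in auto)
qed

text \<open>\<open>S\<close> is its own double orthogonal complement, and for \<open>w\<close>
  orthogonal to \<open>S\<close> the function \<open>F s \<bullet> w\<close> vanishes near
  \<open>t\<close>, so its derivative \<open>v \<bullet> w\<close> is zero.\<close>

lemma has_vector_derivative_in_subspace:
  fixes F :: "real \<Rightarrow> 'a::euclidean_space"
  assumes F: "(F has_vector_derivative v) (at t)" and S: "subspace S"
    and ev: "eventually (\<lambda>s. F s \<in> S) (nhds t)"
  shows "v \<in> S"
proof -
  have "v \<bullet> w = 0" if w: "w \<in> orthogonal_comp S" for w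
  proof -
    have "((\<lambda>s. F s \<bullet> w) has_vector_derivative v \<bullet> w) (at t)"
      by (rule bounded_linear.has_vector_derivative[OF bounded_linear_inner_left F])
    then have "((\<lambda>s. F s \<bullet> w) has_field_derivative v \<bullet> w) (at t)"
      by (simp add: has_real_derivative_iff_has_vector_derivative)
    moreover have "eventually (\<lambda>s. F s \<bullet> w = 0) (nhds t)"
      using ev by eventually_elim (use w in \<open>auto simp: orthogonal_comp_def orthogonal_def inner_commute\<close>)
    then have "((\<lambda>s. F s \<bullet> w) has_field_derivative v \<bullet> w) (at t) \<longleftrightarrow>
        ((\<lambda>s. 0) has_field_derivative v \<bullet> w) (at t)"
      by (intro DERIV_cong_ev) auto
    ultimately have "((\<lambda>s::real. 0::real) has_field_derivative v \<bullet> w) (at t)" by simp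
    then show ?thesis using DERIV_unique DERIV_const by blast
  qed
  then have "v \<in> orthogonal_comp (orthogonal_comp S)"
    by (auto simp: orthogonal_comp_def orthogonal_def inner_commute)
  then show ?thesis using S by (simp add: orthogonal_comp_self)
qed

text \<open>The images of a basis of \<open>S\<close> span the image of \<open>S\<close>, so the
  dimension hypothesis forces them to be distinct and independent.\<close>

lemma inj_on_subspace_of_dim_image:
  fixes f :: "'a::euclidean_space \<Rightarrow> 'b::euclidean_space"
  assumes f: "linear f" and S: "subspace S" and dim: "dim S \<le> dim (f ` S)"
    and v: "v \<in> S" "f v = 0"
  shows "v = 0"
proof -
  obtain B where B: "B \<subseteq> S" "independent B" "S \<subseteq> span B" "card B = dim S"
    using basis_exists by blast
  have spanB: "span B = S" using B S by (simp add: span_minimal subset_antisym)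
  have "finite B" using B(2) by (rule independent_imp_finite)
  have fS: "f ` S = span (f ` B)" using spanB linear_span_image[OF f] by metis
  have "dim (f ` S) \<le> card (f ` B)"
    unfolding fS dim_span using \<open>finite B\<close> by (intro dim_le_card') auto
  moreover have "card (f ` B) \<le> card B" using \<open>finite B\<close> by (rule card_image_le)
  ultimately have card: "card (f ` B) = card B" "dim (f ` B) = card (f ` B)"
    using dim B(4) unfolding fS dim_span by auto
  then have "independent (f ` B)" "inj_on f B"
    using \<open>finite B\<close> by (auto simp: card_eq_dim[of "f ` B" "f ` B"] span_superset eq_card_imp_inj_on)
  then have "inj_on f S"
    using linear_inj_on_span_iff_independent_image[OF f] spanB by metis
  then show ?thesis
    using v S f by (metis inj_onD linear_0 subspace_0)
qed

text \<open>Seen in the chart, a curve in \<open>M\<close> through \<open>p\<close> runs in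
  \<open>S\<close> for small times, so \<open>f' v\<close> lies in \<open>S\<close>; differentiating
  \<open>g (f x) = x\<close> recovers \<open>v\<close> as \<open>g' (f' v)\<close>. The inclusion
  bounds the rank on the tangent space by the rank on \<open>S\<close>.\<close>

lemma tangent_space_subset_chart_image:
  fixes f :: "'a::euclidean_space \<Rightarrow> 'b::euclidean_space"
  assumes diff: "C1_diffeo U V f g" and p: "p \<in> U" and chart: "f ` (U \<inter> M) = V \<inter> S"
    and S: "subspace S" and g': "(g has_derivative g') (at (f p))"
  shows "tangent_space M p \<subseteq> g' ` S"
proof
  fix v assume "v \<in> tangent_space M p"
  then obtain \<epsilon> \<gamma> where \<gamma>: "\<epsilon> > 0" "\<gamma> ` {-\<epsilon><..<\<epsilon>} \<subseteq> M" "\<gamma> 0 = p"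
      "(\<gamma> has_vector_derivative v) (at (0::real))"
    unfolding tangent_space_def by blast
  from diff obtain f' where U: "open U" and gf: "\<And>x. x \<in> U \<Longrightarrow> g (f x) = x"
      and f': "(f has_derivative f') (at p)"
    using p by (auto simp: C1_diffeo_def C1_on_def homeomorphism_def)
  have vel: "((f \<circ> \<gamma>) has_vector_derivative f' v) (at 0)"
  proof -
    have "((f \<circ> \<gamma>) has_derivative f' \<circ> (\<lambda>t. t *\<^sub>R v)) (at 0)"
      using f' \<gamma>(3,4) by (intro diff_chain_at) (auto simp: has_vector_derivative_def)
    moreover have "f' \<circ> (\<lambda>t. t *\<^sub>R v) = (\<lambda>t. t *\<^sub>R f' v)"
      using f' by (auto simp: linear_scale has_derivative_linear)
    ultimately show ?thesis by (simp add: has_vector_derivative_def)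
  qed
  have "eventually (\<lambda>t. (f \<circ> \<gamma>) t \<in> S) (nhds 0)"
  proof -
    have "isCont \<gamma> 0"
      using \<gamma>(4) by (rule has_vector_derivative_continuous)
    then have "(\<gamma> \<longlongrightarrow> p) (nhds 0)"
      using \<gamma>(3) tendsto_at_iff_tendsto_nhds[of \<gamma> 0] by (simp add: isCont_def)
    then have "eventually (\<lambda>t. \<gamma> t \<in> U) (nhds 0)"
      using U p by (rule topological_tendstoD)
    moreover have "eventually (\<lambda>t. t \<in> {-\<epsilon><..<\<epsilon>}) (nhds (0::real))"
      using \<gamma>(1) by (intro eventually_nhds_in_open) auto
    ultimately show ?thesis
    proof eventually_elim
      case (elim t)
      then have "f (\<gamma> t) \<in> f ` (U \<inter> M)" using \<gamma>(2) by blast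
      then show ?case using chart by simp
    qed
  qed
  from has_vector_derivative_in_subspace[OF vel S this] have "f' v \<in> S" .
  moreover have "v = g' (f' v)"
  proof -
    have "((\<lambda>x. g (f x)) has_derivative (\<lambda>x. g' (f' x))) (at p)"
      using has_derivative_compose[OF f' g'] by simp
    then have "((\<lambda>x. x) has_derivative (\<lambda>x. g' (f' x))) (at p)"
      by (rule has_derivative_transform_within_open[OF _ U p]) (simp add: gf)
    from has_derivative_unique[OF this has_derivative_ident] show ?thesis by metis
  qed
  ultimately show "v \<in> g' ` S" by blast
qed

section \<open>The encoding map\<close>

lemma C1_on_of_C2_on: "C2_on U f \<Longrightarrow> C1_on U f"
  unfolding C2_on_def C1_on_def
  by (meson continuous_at_imp_continuous_on has_derivative_continuous)

lemma C1_on_vec_lambda: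
  fixes \<phi> :: "'n::finite \<Rightarrow> 'a::real_normed_vector \<Rightarrow> real"
  assumes "\<And>j. C1_on U (\<phi> j)"
  shows "C1_on U (\<lambda>x. \<chi> j. \<phi> j x)"
proof -
  have "\<forall>j. \<exists>f'. (\<forall>x\<in>U. (\<phi> j has_derivative blinfun_apply (f' x)) (at x)) \<and> continuous_on U f'"
    using assms unfolding C1_on_def by blast
  then obtain f' where f': "\<And>j x. x \<in> U \<Longrightarrow> (\<phi> j has_derivative blinfun_apply (f' j x)) (at x)"
      "\<And>j. continuous_on U (f' j)"
    by metis
  have eq: "(\<chi> j. \<phi> j x) = (\<Sum>j\<in>UNIV. \<phi> j x *\<^sub>R axis j 1)" for x
    by (simp add: vec_eq_iff axis_def if_distrib cong: if_cong)
  \<comment> \<open>As a sum of compositions of bounded operators, \<open>H'\<close> inherits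
    operator-norm continuity from the \<open>f' j\<close>.\<close>
  define H' where "H' x = (\<Sum>j\<in>UNIV. blinfun_scaleR_left (axis j 1 :: real ^ 'n) o\<^sub>L f' j x)" for x
  have "((\<lambda>x. \<chi> j. \<phi> j x) has_derivative blinfun_apply (H' x)) (at x)" if "x \<in> U" for x
  proof -
    have "((\<lambda>x. \<Sum>j\<in>UNIV. \<phi> j x *\<^sub>R (axis j 1 :: real ^ 'n)) has_derivative
        (\<lambda>v. \<Sum>j\<in>UNIV. f' j x v *\<^sub>R axis j 1)) (at x)"
      by (intro has_derivative_sum has_derivative_scaleR_left f' that)
    moreover have "blinfun_apply (H' x) = (\<lambda>v. \<Sum>j\<in>UNIV. f' j x v *\<^sub>R axis j 1)"
      by (rule ext) (simp add: H'_def blinfun.sum_left)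
    ultimately show ?thesis by (simp add: eq)
  qed
  moreover have "continuous_on U H'"
    unfolding H'_def by (intro continuous_intros f')
  ultimately show ?thesis unfolding C1_on_def by blast
qed

lemma C1_on_lipschitz_on_cball:
  fixes h :: "'a::euclidean_space \<Rightarrow> 'b::real_normed_vector"
  assumes "C1_on UNIV h"
  shows "\<exists>B. B-lipschitz_on (cball a R) h"
proof -
  from assms obtain h' where h': "\<And>x. (h has_derivative blinfun_apply (h' x)) (at x)"
      "continuous_on UNIV h'"
    by (auto simp: C1_on_def)
  have "compact (h' ` cball a R)"
    using h'(2) by (intro compact_continuous_image continuous_on_subset[OF h'(2)]) auto
  then obtain B where B: "B > 0" "\<And>x. x \<in> cball a R \<Longrightarrow> norm (h' x) \<le> B"
    by (auto dest!: compact_imp_bounded simp: bounded_pos)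
  have "B-lipschitz_on (cball a R) h"
  proof (rule lipschitz_onI)
    fix x y assume "x \<in> cball a R" "y \<in> cball a R"
    then show "dist (h x) (h y) \<le> B * dist x y"
      unfolding dist_norm
      by (intro differentiable_bound[OF convex_cball has_derivative_at_withinI[OF h'(1)]])
        (use B in \<open>auto simp: norm_blinfun.rep_eq\<close>)
  qed (use B in simp)
  then show ?thesis ..
qed

text \<open>The curve is cut into pieces over [-m, m], because \<open>h\<close> is known to be
  Lipschitz only on balls. Since \<open>E\<close> is Borel and \<open>f\<close> continuous, the
  parameter set \<open>?A\<close> is measurable.\<close>

lemma hausdorff1_null_image_on_Lipschitz_curve:
  fixes f :: "real \<Rightarrow> 'a::euclidean_space" and h :: "'a \<Rightarrow> real ^ 'n"
  assumes lip: "L-lipschitz_on UNIV f" and h: "C1_on UNIV h" and E: "E \<in> sets borel"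
    and null: "\<And>j. hausdorff1 ((\<lambda>x. h x $ j) ` E) = 0"
  shows "hausdorff1 (h ` (E \<inter> range f)) = 0"
proof -
  let ?A = "f -` E"
  have "f \<in> borel_measurable borel"
    using lip by (intro borel_measurable_continuous_onI lipschitz_on_continuous_on)
  then have "?A \<in> sets borel"
    using E by (rule measurable_sets_borel)
  then have A: "?A \<in> sets lebesgue" by auto
  have "hausdorff1 ((h \<circ> f) ` (?A \<inter> {- real m..real m})) = 0" for m
  proof -
    have lipm: "L-lipschitz_on {- real m..real m} f"
      using lip by (rule lipschitz_on_subset) simp
    have "compact (f ` {- real m..real m})"
      by (intro compact_continuous_image lipschitz_on_continuous_on[OF lipm] compact_Icc)
    then obtain c R where "f ` {- real m..real m} \<subseteq> cball c R"
      by (auto dest!: compact_imp_bounded simp: bounded_subset_cball)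
    moreover obtain B where "B-lipschitz_on (cball c R) h"
      using C1_on_lipschitz_on_cball[OF h] by blast
    ultimately have "(B * L)-lipschitz_on {- real m..real m} (h \<circ> f)"
      by (intro lipschitz_on_compose lipm) (rule lipschitz_on_subset)
    moreover have "hausdorff1 ((\<lambda>t. (h \<circ> f) t $ j) ` (?A \<inter> {- real m..real m})) = 0" for j
      by (rule hausdorff1_null_mono[OF null[of j]]) auto
    ultimately show ?thesis
      by (intro hausdorff1_curve_null_of_coordinates_null[OF _ A])
  qed
  then have "hausdorff1 (\<Union>m. (h \<circ> f) ` (?A \<inter> {- real m..real m})) = 0"
    by (rule hausdorff1_null_UN)
  moreover have "h ` (E \<inter> range f) \<subseteq> (\<Union>m. (h \<circ> f) ` (?A \<inter> {- real m..real m}))"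
  proof clarify
    fix t assume t: "f t \<in> E"
    obtain m where "\<bar>t\<bar> \<le> real m" using real_arch_simple by blast
    then have "t \<in> ?A \<inter> {- real m..real m}" using t by (auto simp: abs_le_iff)
    then have "h (f t) \<in> (h \<circ> f) ` (?A \<inter> {- real m..real m})"
      by (metis comp_apply imageI)
    then show "h (f t) \<in> (\<Union>m. (h \<circ> f) ` (?A \<inter> {- real m..real m}))" by blast
  qed
  ultimately show ?thesis by (rule hausdorff1_null_mono)
qed

text \<open>In a chart \<open>M\<close> becomes a piece of the subspace \<open>S\<close>, so
  differences of its points stay in \<open>S\<close> and the lower bound for
  \<open>h \<circ> g\<close> along \<open>S\<close> applies. Leaving the chart costs a Lipschitz
  constant of \<open>g\<close>.\<close>

lemma submanifold_lower_Lipschitz_near: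
  fixes h :: "'a::euclidean_space \<Rightarrow> 'b::euclidean_space" and h' :: "'a \<Rightarrow> 'a \<Rightarrow>\<^sub>L 'b"
  assumes M: "C1_submanifold k M" and p: "p \<in> M"
    and der: "\<And>x. (h has_derivative h' x) (at x)" and cont: "continuous_on UNIV h'"
    and dim: "dim (h' p ` tangent_space M p) = k"
  obtains W C where "open W" "p \<in> W"
    "\<And>x y. x \<in> M \<inter> W \<Longrightarrow> y \<in> M \<inter> W \<Longrightarrow> dist x y \<le> C * dist (h x) (h y)"
proof -
  obtain U V S and f g :: "'a \<Rightarrow> 'a" where pU: "p \<in> U" and diff: "C1_diffeo U V f g"
    and S: "subspace S" "dim S = k" and chart: "f ` (U \<inter> M) = V \<inter> S"
    using M[unfolded C1_submanifold_def, rule_format, OF p] by (elim exE conjE) (rule that, assumption+)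
  have U: "open U" and V: "open V" and contf: "continuous_on U f" and contg: "continuous_on V g"
    and fU: "\<And>x. x \<in> U \<Longrightarrow> f x \<in> V" and gf: "\<And>x. x \<in> U \<Longrightarrow> g (f x) = x"
    using diff by (auto simp: C1_diffeo_def homeomorphism_def)
  from diff obtain g' where g': "\<And>x. x \<in> V \<Longrightarrow> (g has_derivative blinfun_apply (g' x)) (at x)"
      "continuous_on V g'"
    by (auto simp: C1_diffeo_def C1_on_def)
  define q where "q = f p"
  have qV: "q \<in> V" using fU pU by (simp add: q_def)
  define k' where "k' y = h' (g y) o\<^sub>L g' y" for y
  have k': "((h \<circ> g) has_derivative blinfun_apply (k' y)) (at y)" if "y \<in> V" for y
  proof -
    have "((h \<circ> g) has_derivative blinfun_apply (h' (g y)) \<circ> blinfun_apply (g' y)) (at y)"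
      by (intro diff_chain_at g'(1) der that)
    then show ?thesis by (simp add: k'_def blinfun_compose.rep_eq)
  qed
  have contk: "continuous_on V k'"
    unfolding k'_def
    by (intro bounded_bilinear.continuous_on[OF bounded_bilinear_blinfun_compose] g'(2)
        continuous_on_compose2[OF cont contg]) auto
  \<comment> \<open>Dimension count: \<open>k = dim (h' p\<close> tangent_space M p) \<le> dim (k' q
    \<open>S)\<close> while \<open>dim S = k\<close>, so \<open>k' q\<close> loses no dimension on
    \<open>S\<close>.\<close>
  have inj: "v = 0" if "v \<in> S" "k' q v = 0" for v
  proof (rule inj_on_subspace_of_dim_image[where f = "blinfun_apply (k' q)", OF _ S(1) _ that])
    show "linear (blinfun_apply (k' q))" by (intro bounded_linear.linear blinfun.bounded_linear_right)
    have "tangent_space M p \<subseteq> g' q ` S"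
      using tangent_space_subset_chart_image[OF diff pU chart S(1)] g'(1)[OF qV] by (simp add: q_def)
    then have "h' p ` tangent_space M p \<subseteq> k' q ` S"
      using gf[OF pU] by (auto simp: k'_def q_def)
    then show "dim S \<le> dim (k' q ` S)"
      using dim S(2) dim_subset by metis
  qed
  obtain r1 C1 where r1: "r1 > 0" "C1 \<ge> 0" "ball q r1 \<subseteq> V"
    "\<And>x y. x \<in> ball q r1 \<Longrightarrow> y \<in> ball q r1 \<Longrightarrow> x - y \<in> S \<Longrightarrow> dist x y \<le> C1 * dist ((h \<circ> g) x) ((h \<circ> g) y)"
    using C1_lower_Lipschitz_near[OF V qV k' contk S(1) inj] by metis
  obtain r2 C2 where r2: "r2 > 0" "C2 \<ge> 0" "ball q r2 \<subseteq> V"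
    "\<And>x y. x \<in> ball q r2 \<Longrightarrow> y \<in> ball q r2 \<Longrightarrow> dist (g x) (g y) \<le> C2 * dist x y"
    using C1_upper_Lipschitz_near[OF V qV g'] by metis
  define W where "W = U \<inter> f -` ball q (min r1 r2)"
  show ?thesis
  proof (rule that[of W "C2 * C1"])
    show "open W" unfolding W_def by (rule continuous_open_preimage[OF contf U open_ball])
    show "p \<in> W" using pU r1 r2 by (simp add: W_def q_def)
    fix x y assume xy: "x \<in> M \<inter> W" "y \<in> M \<inter> W"
    have S': "f z \<in> S" "g (f z) = z" "f z \<in> ball q r1" "f z \<in> ball q r2" if "z \<in> M \<inter> W" for z
      using that chart gf by (auto simp: W_def)
    have "dist x y \<le> C2 * dist (f x) (f y)"
      using r2(4)[of "f x" "f y"] S' xy by simp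
    also have "\<dots> \<le> C2 * (C1 * dist (h x) (h y))"
      using r1(4)[of "f x" "f y"] S' xy subspace_diff[OF S(1)] r2(2)
      by (intro mult_left_mono) auto
    finally show "dist x y \<le> C2 * C1 * dist (h x) (h y)" by (simp add: mult.assoc)
  qed
qed

lemma regular_point_injective:
  fixes \<phi> :: "'n::finite \<Rightarrow> real ^ 'n \<Rightarrow> real"
  assumes p: "p \<notin> critical_set \<phi>" and D: "(encoding_map \<phi> has_derivative D) (at p)"
    and v: "D v = 0"
  shows "v = 0"
proof -
  have "frechet_derivative (encoding_map \<phi>) (at p) = D"
    using frechet_derivative_at[OF D] by simp
  with p have "\<not> rank (matrix D) \<le> CARD('n) - 1"
    by (simp add: critical_set_def)
  \<comment> \<open>The truncated subtraction does no harm, since a finite type has at least one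
    element.\<close>
  then have "\<not> rank (matrix D) < CARD('n)" by simp
  then have "inj ((*v) (matrix D))" by (simp add: less_rank_noninjective)
  moreover have "linear D" using D by (rule has_derivative_linear)
  ultimately have "inj D" by (simp add: matrix_works inj_on_def)
  then show ?thesis using v linear_0[OF \<open>linear D\<close>] by (metis injD)
qed

theorem theorem1p4:
  fixes \<phi> :: "'n::finite \<Rightarrow> real ^ 'n \<Rightarrow> real"
  assumes "CARD('n) \<ge> 2"
    and "\<And>j. C2_on UNIV (\<phi> j)"
    and "admissible \<phi>"
  shows "(\<forall>E. borel_rectifiable1 E \<and> hausdorff1 E > 0 \<longrightarrow> (\<exists>j. hausdorff1 (\<phi> j ` E) > 0))
    \<and> good_witness_property \<phi>"
proof -
  let ?H = "encoding_map \<phi>"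
  have C1: "C1_on UNIV ?H"
    unfolding encoding_map_def by (intro C1_on_vec_lambda C1_on_of_C2_on assms(2))
  then obtain H' where H': "\<And>x. (?H has_derivative blinfun_apply (H' x)) (at x)" "continuous_on UNIV H'"
    by (auto simp: C1_on_def)
  have frechet: "frechet_derivative ?H (at x) = H' x" for x
    using frechet_derivative_at[OF H'(1)] by simp
  from assms(3) obtain M where M: "C1_submanifold (CARD('n) - 1) M" "critical_set \<phi> \<subseteq> M"
      "\<And>x. x \<in> M \<Longrightarrow> dim (H' x ` tangent_space M x) = CARD('n) - 1"
    unfolding admissible_def frechet by blast
  have main: "\<exists>j. hausdorff1 (\<phi> j ` E) > 0" if E: "borel_rectifiable1 E" "hausdorff1 E > 0" for E
  proof (rule ccontr)
    assume "\<nexists>j. hausdorff1 (\<phi> j ` E) > 0"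
    then have null: "hausdorff1 (\<phi> j ` E) = 0" for j by simp
    from E(1) obtain f :: "nat \<Rightarrow> real \<Rightarrow> real ^ 'n" where Eb: "E \<in> sets borel"
      and f: "\<And>i. \<exists>L. L-lipschitz_on UNIV (f i)" "hausdorff1 (E - (\<Union>i. range (f i))) = 0"
      unfolding borel_rectifiable1_def by blast
    define F where "F = E \<inter> (\<Union>i. range (f i))"
    have "hausdorff1 (?H ` (E \<inter> range (f i))) = 0" for i
    proof -
      from f(1)[of i] obtain L where "L-lipschitz_on UNIV (f i)" by blast
      then show ?thesis
        by (rule hausdorff1_null_image_on_Lipschitz_curve[OF _ C1 Eb]) (simp add: encoding_map_def null)
    qed
    then have "hausdorff1 (\<Union>i. ?H ` (E \<inter> range (f i))) = 0"
      by (rule hausdorff1_null_UN)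
    then have HF: "hausdorff1 (?H ` F) = 0"
      by (rule hausdorff1_null_mono) (auto simp: F_def)
    have local_null: "hausdorff1 (F \<inter> T \<inter> W) = 0"
      if "\<And>x y. x \<in> T \<inter> W \<Longrightarrow> y \<in> T \<inter> W \<Longrightarrow> dist x y \<le> C * dist (?H x) (?H y)" for T W C
      by (rule hausdorff1_null_of_lower_Lipschitz[where h = ?H and C = C])
        (auto intro: that hausdorff1_null_mono[OF HF])
    have "hausdorff1 (F \<inter> M) = 0"
    proof (rule hausdorff1_null_local)
      fix p assume p: "p \<in> M"
      obtain W C where "open W" "p \<in> W"
        "\<And>x y. x \<in> M \<inter> W \<Longrightarrow> y \<in> M \<inter> W \<Longrightarrow> dist x y \<le> C * dist (?H x) (?H y)"
        using submanifold_lower_Lipschitz_near[OF M(1) p H' M(3)[OF p]] by metis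
      then show "\<exists>U. open U \<and> p \<in> U \<and> hausdorff1 (F \<inter> M \<inter> U) = 0"
        using local_null by metis
    qed
    moreover have "hausdorff1 (F \<inter> - critical_set \<phi>) = 0"
    proof (rule hausdorff1_null_local)
      fix p assume p: "p \<in> - critical_set \<phi>"
      have inj: "v = 0" if "H' p v = 0" for v
        by (rule regular_point_injective[OF _ H'(1) that]) (use p in simp)
      \<comment> \<open>At a regular point the derivative is injective on all of space, so
        \<open>S = UNIV\<close> puts no constraint on \<open>x - y\<close>.\<close>
      obtain r C where r: "r > 0"
        "\<And>x y. x \<in> ball p r \<Longrightarrow> y \<in> ball p r \<Longrightarrow> x - y \<in> UNIV \<Longrightarrow> dist x y \<le> C * dist (?H x) (?H y)"
        using C1_lower_Lipschitz_near[OF open_UNIV UNIV_I H' subspace_UNIV inj] by metis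
      have "hausdorff1 (F \<inter> - critical_set \<phi> \<inter> ball p r) = 0"
      proof (rule local_null[where C = C])
        fix x y assume "x \<in> - critical_set \<phi> \<inter> ball p r" "y \<in> - critical_set \<phi> \<inter> ball p r"
        then show "dist x y \<le> C * dist (?H x) (?H y)" using r(2)[of x y] by simp
      qed
      with r(1) show "\<exists>U. open U \<and> p \<in> U \<and> hausdorff1 (F \<inter> - critical_set \<phi> \<inter> U) = 0"
        by (metis centre_in_ball open_ball)
    qed
    ultimately have "hausdorff1 (F \<inter> M \<union> F \<inter> - critical_set \<phi>) = 0"
      by (rule hausdorff1_null_Un)
    then have "hausdorff1 ((F \<inter> M \<union> F \<inter> - critical_set \<phi>) \<union> (E - (\<Union>i. range (f i)))) = 0"
      by (rule hausdorff1_null_Un[OF _ f(2)])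
    \<comment> \<open>Since \<open>critical_set \<phi> \<subseteq> M\<close>, every point of
      \<open>F\<close> lies in \<open>M\<close> or is regular; the rest of \<open>E\<close> is the
      exceptional null part.\<close>
    then have "hausdorff1 E = 0"
      by (rule hausdorff1_null_mono) (use M(2) in \<open>auto simp: F_def\<close>)
    with E(2) show False by simp
  qed
  then show ?thesis
    unfolding good_witness_property_def rectifiable_1set_def by blast
qed

end
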